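(* $\textsc{Three-valued Ccv}$ and $\textsc{Ccv}$ are equivalent under $\mathsf{AC}^0$ many-one reductions.
   Context: $\textsc{Ccv}$: given a comparator circuit (wires and a sequence of comparator gates, each mapping the values $(p,q)$ of two wires to $(p\wedge q,p\vee q)$), a Boolean input value for each wire and a designated wire, decide whether that wire outputs $1$. $\textsc{Three-valued Ccv}$ is the same problem except that wires take values in $\{0,1,\ast\}$ and comparator gates use three-valued operations: $p\wedge q=0$ if $p=0$ or $q=0$, $=1$ if $p=q=1$, and $=\ast$ otherwise; $p\vee q=0$ if $p=q=0$, $=1$ if $p=1$ or $q=1$, and $=\ast$ otherwise. $A$ is $\mathsf{AC}^0$ many-one reducible to $B$ if there is a uniform $\mathsf{AC}^0$ computable function $F$ with $A(X)\leftrightarrow B(F(X))$. *)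

theory Defs
  imports Main
begin

section \<open>Comparator circuits\<close>

text \<open>The gate \<open>(a, b)\<close> sends the values \<open>(p, q)\<close> of the two distinct wires \<open>a\<close>, \<open>b\<close>
  to \<open>(p \<and> q, p \<or> q)\<close>: the conjunction stays on \<open>a\<close>, the disjunction on \<open>b\<close>.\<close>

record 'v ccv_instance =
  wires :: nat
  gates :: "(nat \<times> nat) list"
  inputs :: "'v list"
  designated :: nat

definition valid_instance :: "'v ccv_instance \<Rightarrow> bool" where
  "valid_instance I \<longleftrightarrow>
     length (inputs I) = wires I \<and> designated I < wires I \<and>
     (\<forall>(a, b) \<in> set (gates I). a < wires I \<and> b < wires I \<and> a \<noteq> b)"

definition comparator ::
  "('v \<Rightarrow> 'v \<Rightarrow> 'v) \<Rightarrow> ('v \<Rightarrow> 'v \<Rightarrow> 'v) \<Rightarrow> nat \<times> nat \<Rightarrow> 'v list \<Rightarrow> 'v list" where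
  "comparator land lor = (\<lambda>(a, b) v. v[a := land (v ! a) (v ! b), b := lor (v ! a) (v ! b)])"

definition circuit_output ::
  "('v \<Rightarrow> 'v \<Rightarrow> 'v) \<Rightarrow> ('v \<Rightarrow> 'v \<Rightarrow> 'v) \<Rightarrow> 'v ccv_instance \<Rightarrow> 'v" where
  "circuit_output land lor I = fold (comparator land lor) (gates I) (inputs I) ! designated I"

datatype three = Zero | One | Star

definition three_and :: "three \<Rightarrow> three \<Rightarrow> three" where
  "three_and p q = (if p = Zero \<or> q = Zero then Zero else if p = One \<and> q = One then One else Star)"

definition three_or :: "three \<Rightarrow> three \<Rightarrow> three" where
  "three_or p q = (if p = Zero \<and> q = Zero then Zero else if p = One \<or> q = One then One else Star)"

section \<open>The decision problems as sets of binary strings\<close>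

text \<open>An instance with \<open>m\<close> wires is written as \<open>1\<^sup>m 0\<close>, the values of the wires, the
  designated wire and the gates, where each wire index is a one-hot block of \<open>m\<close> bits.  Blocks of
  fixed width are needed: locating the \<open>k\<close>-th item of a variable-width encoding amounts to counting,
  which \<open>AC\<^sup>0\<close> cannot do.\<close>

definition one_hot :: "nat \<Rightarrow> nat \<Rightarrow> bool list" where
  "one_hot m a = map (\<lambda>k. k = a) [0..<m]"

definition encode_instance :: "('v \<Rightarrow> bool list) \<Rightarrow> 'v ccv_instance \<Rightarrow> bool list" where
  "encode_instance enc I =
     replicate (wires I) True @ [False] @
     concat (map enc (inputs I)) @
     one_hot (wires I) (designated I) @
     concat (map (\<lambda>(a, b). one_hot (wires I) a @ one_hot (wires I) b) (gates I))"

fun encode_bool :: "bool \<Rightarrow> bool list" where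
  "encode_bool b = [b]"

fun encode_three :: "three \<Rightarrow> bool list" where
  "encode_three Zero = [False, False]"
| "encode_three One = [False, True]"
| "encode_three Star = [True, False]"

definition CCV :: "bool list set" where
  "CCV = {encode_instance encode_bool I | I.
            valid_instance I \<and> circuit_output (\<and>) (\<or>) I = True}"

definition Three_valued_CCV :: "bool list set" where
  "Three_valued_CCV = {encode_instance encode_three I | I.
            valid_instance I \<and> circuit_output three_and three_or I = One}"

section \<open>Boolean circuits of unbounded fan-in\<close>

text \<open>A circuit is a topologically sorted list of gates; a gate refers to its predecessors by
  their positions in the list, and the last gate is the output.\<close>

datatype gate = GInput nat | GNot nat | GAnd "nat set" | GOr "nat set"

fun preds :: "gate \<Rightarrow> nat set" where
  "preds (GInput k) = {}"
| "preds (GNot h) = {h}"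
| "preds (GAnd S) = S"
| "preds (GOr S) = S"

definition wf_circuit :: "nat \<Rightarrow> gate list \<Rightarrow> bool" where
  "wf_circuit n C \<longleftrightarrow> C \<noteq> [] \<and>
     (\<forall>g < length C. preds (C ! g) \<subseteq> {..<g} \<and> (\<forall>k. C ! g = GInput k \<longrightarrow> k < n))"

fun gate_value :: "bool list \<Rightarrow> bool list \<Rightarrow> gate \<Rightarrow> bool" where
  "gate_value X v (GInput k) = X ! k"
| "gate_value X v (GNot h) = (\<not> v ! h)"
| "gate_value X v (GAnd S) = (\<forall>h\<in>S. v ! h)"
| "gate_value X v (GOr S) = (\<exists>h\<in>S. v ! h)"

definition circuit_value :: "gate list \<Rightarrow> bool list \<Rightarrow> bool" where
  "circuit_value C X = last (foldl (\<lambda>v g. v @ [gate_value X v g]) [] C)"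

definition gate_depths :: "gate list \<Rightarrow> nat list" where
  "gate_depths C =
     foldl (\<lambda>d g. d @ [if preds g = {} then 0 else Suc (Max ((!) d ` preds g))]) [] C"

section \<open>Uniformity\<close>

text \<open>Bounded-quantifier formulas of arithmetic.  On arguments that are polynomially bounded in the
  input length these define the same relations as first-order logic with \<open>+\<close> and \<open>\<times>\<close> (or \<open>BIT\<close>)
  over the positions of the input, that is, the logarithmic-time hierarchy; used for the connection
  relations of circuits this is first-order uniformity, which for constant depth and polynomial size
  yields the same class as \<open>DLOGTIME\<close>-uniformity.\<close>

datatype arith = Var nat | Zer | Uno | Plus arith arith | Times arith arith

fun arith_val :: "(nat \<Rightarrow> nat) \<Rightarrow> arith \<Rightarrow> nat" where
  "arith_val e (Var x) = e x"
| "arith_val e Zer = 0"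
| "arith_val e Uno = 1"
| "arith_val e (Plus s t) = arith_val e s + arith_val e t"
| "arith_val e (Times s t) = arith_val e s * arith_val e t"

datatype bformula =
  LessEq arith arith
| Neg bformula
| Conj bformula bformula
| BEx nat arith bformula

fun holds :: "(nat \<Rightarrow> nat) \<Rightarrow> bformula \<Rightarrow> bool" where
  "holds e (LessEq s t) \<longleftrightarrow> arith_val e s \<le> arith_val e t"
| "holds e (Neg \<phi>) \<longleftrightarrow> \<not> holds e \<phi>"
| "holds e (Conj \<phi> \<psi>) \<longleftrightarrow> holds e \<phi> \<and> holds e \<psi>"
| "holds e (BEx x t \<phi>) \<longleftrightarrow> (\<exists>a \<le> arith_val e t. holds (e(x := a)) \<phi>)"

definition bounded_definable :: "(nat \<Rightarrow> nat \<Rightarrow> nat \<Rightarrow> nat \<Rightarrow> bool) \<Rightarrow> bool" where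
  "bounded_definable R \<longleftrightarrow> (\<exists>\<phi>. \<forall>e. holds e \<phi> \<longleftrightarrow> R (e 0) (e 1) (e 2) (e 3))"

definition uniform_family :: "(nat \<Rightarrow> nat \<Rightarrow> gate list) \<Rightarrow> bool" where
  "uniform_family C \<longleftrightarrow>
     bounded_definable (\<lambda>n i g h. g < length (C n i)) \<and>
     bounded_definable (\<lambda>n i g h. g < length (C n i) \<and> C n i ! g = GInput h) \<and>
     bounded_definable (\<lambda>n i g h. g < length (C n i) \<and> C n i ! g = GNot h) \<and>
     bounded_definable (\<lambda>n i g h. g < length (C n i) \<and> (\<exists>S. C n i ! g = GAnd S)) \<and>
     bounded_definable (\<lambda>n i g h. g < length (C n i) \<and> (\<exists>S. C n i ! g = GOr S)) \<and>
     bounded_definable (\<lambda>n i g h. g < length (C n i) \<and> h \<in> preds (C n i ! g))"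

section \<open>Uniform \<open>AC\<^sup>0\<close> and reductions\<close>

text \<open>For a relation \<open>R(i, X)\<close> with a number argument \<open>i\<close>, presented in unary, and a string argument
  \<open>X\<close>, the circuit family is indexed by the lengths of the two arguments; a unary argument carries
  no further information.\<close>

definition uniform_AC0 :: "(nat \<Rightarrow> bool list \<Rightarrow> bool) \<Rightarrow> bool" where
  "uniform_AC0 R \<longleftrightarrow>
     (\<exists>C c d. uniform_family C \<and>
        (\<forall>n i. wf_circuit n (C n i) \<and>
               length (C n i) \<le> (n + i) ^ c + c \<and>
               (\<forall>k \<in> set (gate_depths (C n i)). k \<le> d)) \<and>
        (\<forall>i X. R i X \<longleftrightarrow> circuit_value (C (length X) i) X))"

text \<open>A string function is computable in \<open>AC\<^sup>0\<close> if it is polynomially bounded and its bit graph is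
  in \<open>AC\<^sup>0\<close>.  As strings are lists, which may end in \<open>0\<close>s, the bit graph comprises both
  ``\<open>F(X)\<close> has an \<open>i\<close>-th bit'' and ``the \<open>i\<close>-th bit of \<open>F(X)\<close> is \<open>1\<close>''.\<close>

definition AC0_function :: "(bool list \<Rightarrow> bool list) \<Rightarrow> bool" where
  "AC0_function F \<longleftrightarrow>
     (\<exists>c. \<forall>X. length (F X) \<le> length X ^ c + c) \<and>
     uniform_AC0 (\<lambda>i X. i < length (F X)) \<and>
     uniform_AC0 (\<lambda>i X. i < length (F X) \<and> F X ! i)"

definition AC0_many_one_reducible :: "bool list set \<Rightarrow> bool list set \<Rightarrow> bool" where
  "AC0_many_one_reducible A B \<longleftrightarrow> (\<exists>F. AC0_function F \<and> (\<forall>X. X \<in> A \<longleftrightarrow> F X \<in> B))"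

definition AC0_many_one_equivalent :: "bool list set \<Rightarrow> bool list set \<Rightarrow> bool" where
  "AC0_many_one_equivalent A B \<longleftrightarrow>
     AC0_many_one_reducible A B \<and> AC0_many_one_reducible B A"

end

theory Submission imports Defs begin

text \<open>Ordered as \<open>0 < \<ast> < 1\<close>, the three-valued connectives are minimum and maximum, hence the
  threshold \<open>p \<mapsto> (p = 1)\<close> and the inclusion \<open>{0, 1} \<subseteq> {0, \<ast>, 1}\<close> are both
  homomorphisms for comparator gates.  So both reductions keep the wires and gates of an instance and
  recode only its inputs.  On strings this shifts bits by amounts depending on the length \<open>m\<close> of the
  unary header, so each bit of the result is a disjunction over \<open>m\<close> of conjunctions of literals; the
  only further condition is that no input of a three-valued instance has the unused code \<open>11\<close>, which
  contributes clauses with two literals.  A single uniform family of circuits of depth 4 evaluates all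
  relations of this shape.\<close>

section \<open>Definability by bounded formulas\<close>

text \<open>Predicates of the whole environment are used because \<open>bounded_definable\<close>
  exposes only variables 0 to 3, while quantified values need further variables.\<close>

definition definable :: "((nat \<Rightarrow> nat) \<Rightarrow> bool) \<Rightarrow> bool" where
  "definable P \<longleftrightarrow> (\<exists>\<phi>. \<forall>e. holds e \<phi> \<longleftrightarrow> P e)"

definition term_definable :: "((nat \<Rightarrow> nat) \<Rightarrow> nat) \<Rightarrow> bool" where
  "term_definable f \<longleftrightarrow> (\<exists>t. \<forall>e. arith_val e t = f e)"

lemma bounded_definable_iff:
  "bounded_definable R \<longleftrightarrow> definable (\<lambda>e. R (e 0) (e 1) (e 2) (e 3))"
  by (simp add: bounded_definable_def definable_def)

lemma term_definable_var: "term_definable (\<lambda>e. e x)"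
  unfolding term_definable_def by (rule exI[of _ "Var x"]) simp

lemma term_definable_plus:
  assumes "term_definable f" "term_definable g"
  shows "term_definable (\<lambda>e. f e + g e)"
proof -
  obtain s t where "\<forall>e. arith_val e s = f e" "\<forall>e. arith_val e t = g e"
    using assms unfolding term_definable_def by blast
  then have "\<forall>e. arith_val e (Plus s t) = f e + g e" by simp
  then show ?thesis unfolding term_definable_def by blast
qed

lemma term_definable_times:
  assumes "term_definable f" "term_definable g"
  shows "term_definable (\<lambda>e. f e * g e)"
proof -
  obtain s t where "\<forall>e. arith_val e s = f e" "\<forall>e. arith_val e t = g e"
    using assms unfolding term_definable_def by blast
  then have "\<forall>e. arith_val e (Times s t) = f e * g e" by simp
  then show ?thesis unfolding term_definable_def by blast
qed

lemma term_definable_const: "term_definable (\<lambda>e. c)"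
proof (induction c)
  case 0
  show ?case unfolding term_definable_def by (rule exI[of _ Zer]) simp
next
  case (Suc c)
  have "term_definable (\<lambda>e. 1)"
    unfolding term_definable_def by (rule exI[of _ Uno]) simp
  from term_definable_plus[OF Suc this] show ?case by simp
qed

lemma definable_le:
  assumes "term_definable f" "term_definable g"
  shows "definable (\<lambda>e. f e \<le> g e)"
proof -
  obtain s t where "\<forall>e. arith_val e s = f e" "\<forall>e. arith_val e t = g e"
    using assms unfolding term_definable_def by blast
  then have "\<forall>e. holds e (LessEq s t) \<longleftrightarrow> f e \<le> g e" by simp
  then show ?thesis unfolding definable_def by blast
qed

lemma definable_not:
  assumes "definable P"
  shows "definable (\<lambda>e. \<not> P e)"
proof -
  obtain \<phi> where "\<forall>e. holds e \<phi> \<longleftrightarrow> P e" using assms unfolding definable_def by blast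
  then have "\<forall>e. holds e (Neg \<phi>) \<longleftrightarrow> \<not> P e" by simp
  then show ?thesis unfolding definable_def by blast
qed

lemma definable_conj:
  assumes "definable P" "definable Q"
  shows "definable (\<lambda>e. P e \<and> Q e)"
proof -
  obtain \<phi> \<psi> where "\<forall>e. holds e \<phi> \<longleftrightarrow> P e" "\<forall>e. holds e \<psi> \<longleftrightarrow> Q e"
    using assms unfolding definable_def by blast
  then have "\<forall>e. holds e (Conj \<phi> \<psi>) \<longleftrightarrow> P e \<and> Q e" by simp
  then show ?thesis unfolding definable_def by blast
qed

lemma definable_disj:
  assumes "definable P" "definable Q"
  shows "definable (\<lambda>e. P e \<or> Q e)"
  using definable_not[OF definable_conj[OF definable_not[OF assms(1)] definable_not[OF assms(2)]]]
  by simp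

lemma definable_imp:
  assumes "definable P" "definable Q"
  shows "definable (\<lambda>e. P e \<longrightarrow> Q e)"
  using definable_disj[OF definable_not[OF assms(1)] assms(2)] by (simp only: imp_conv_disj)

lemma definable_less:
  assumes "term_definable f" "term_definable g"
  shows "definable (\<lambda>e. f e < g e)"
  using definable_not[OF definable_le[OF assms(2,1)]] by (simp add: not_le)

lemma definable_eq:
  assumes "term_definable f" "term_definable g"
  shows "definable (\<lambda>e. f e = g e)"
  using definable_conj[OF definable_le[OF assms] definable_le[OF assms(2,1)]]
  by (simp add: eq_iff)

lemma definable_False: "definable (\<lambda>e. False)"
  using definable_less[OF term_definable_const[of 0] term_definable_const[of 0]] by simp

text \<open>The witness is a separate argument of \<open>P\<close>; freshness says that
  \<open>P\<close> does not read the environment at \<open>x\<close>, so \<open>x\<close> is free to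
  store the witness.\<close>

lemma definable_bex:
  assumes "term_definable f" "definable (\<lambda>e. P (e x) e)"
    and fresh: "\<And>a b e. P a (e(x := b)) \<longleftrightarrow> P a e"
  shows "definable (\<lambda>e. \<exists>a \<le> f e. P a e)"
proof -
  obtain t \<phi> where "\<forall>e. arith_val e t = f e" "\<forall>e. holds e \<phi> \<longleftrightarrow> P (e x) e"
    using assms(1,2) unfolding definable_def term_definable_def by blast
  then have "\<forall>e. holds e (BEx x t \<phi>) \<longleftrightarrow> (\<exists>a \<le> f e. P a e)" by (simp add: fresh)
  then show ?thesis unfolding definable_def by blast
qed

text \<open>In place of a substitution into the formula, variable 2 is requantified: the bound
  \<open>Var x\<close> and the reverse inequality force it to agree with \<open>x\<close>.\<close>

lemma definable_third_argument:
  assumes "bounded_definable R" and x: "x > 3"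
  shows "definable (\<lambda>e. R (e 0) (e 1) (e x) (e 3))"
proof -
  obtain \<phi> where \<phi>: "\<forall>e. holds e \<phi> \<longleftrightarrow> R (e 0) (e 1) (e 2) (e 3)"
    using assms unfolding bounded_definable_def by blast
  have "holds e (BEx 2 (Var x) (Conj (LessEq (Var x) (Var 2)) \<phi>)) \<longleftrightarrow> R (e 0) (e 1) (e x) (e 3)"
    for e
    using x by (auto simp: \<phi>)
  then show ?thesis unfolding definable_def by blast
qed

lemmas definable_intros =
  term_definable_var term_definable_plus term_definable_times term_definable_const
  definable_le definable_less definable_eq definable_False
  definable_not definable_conj definable_disj definable_imp

section \<open>Evaluation and depth of circuits\<close>

text \<open>Predecessors have smaller positions, so the local gate equations determine all values.
  Evaluation thus reduces to guessing a list of values and checking each gate.\<close>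

lemma foldl_gate_value_eqI:
  assumes wf: "wf_circuit n C" and len: "length v = length C"
    and v: "\<And>g. g < length C \<Longrightarrow> v ! g = gate_value X v (C ! g)"
  shows "foldl (\<lambda>v g. v @ [gate_value X v g]) [] C = v"
proof -
  have "k \<le> length C \<Longrightarrow> foldl (\<lambda>v g. v @ [gate_value X v g]) [] (take k C) = take k v" for k
  proof (induction k)
    case (Suc k)
    then have k: "k < length C" by simp
    have "preds (C ! k) \<subseteq> {..<k}" using wf k by (simp add: wf_circuit_def)
    then have "gate_value X (take k v) (C ! k) = gate_value X v (C ! k)"
      by (cases "C ! k") (auto simp: subset_iff)
    then show ?case
      using Suc k len v[OF k] by (simp add: take_Suc_conv_app_nth)
  qed simp
  from this[of "length C"] show ?thesis by (simp add: len)
qed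

text \<open>Depth is the length of a longest path, so any level that strictly increases along the
  wires dominates it.\<close>

lemma gate_depths_le:
  assumes wf: "wf_circuit n C"
    and lvl: "\<And>g h. g < length C \<Longrightarrow> h \<in> preds (C ! g) \<Longrightarrow> lvl h < lvl g"
    and bound: "\<And>g. g < length C \<Longrightarrow> lvl g \<le> d"
  shows "\<forall>k \<in> set (gate_depths C). k \<le> d"
proof -
  define D where
    "D = foldl (\<lambda>d g. d @ [if preds g = {} then 0 else Suc (Max ((!) d ` preds g))]) []"
  have "k \<le> length C \<Longrightarrow> length (D (take k C)) = k \<and> (\<forall>j<k. D (take k C) ! j \<le> lvl j)" for k
  proof (induction k)
    case 0
    show ?case by (simp add: D_def)
  next
    case (Suc k)
    then have k: "k < length C" and len: "length (D (take k C)) = k"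
      and IH: "\<And>j. j < k \<Longrightarrow> D (take k C) ! j \<le> lvl j" by auto
    have sub: "preds (C ! k) \<subseteq> {..<k}" using wf k by (simp add: wf_circuit_def)
    then have fin: "finite (preds (C ! k))" by (rule finite_subset) simp
    have step: "D (take (Suc k) C) = D (take k C) @
        [if preds (C ! k) = {} then 0 else Suc (Max ((!) (D (take k C)) ` preds (C ! k)))]"
      using k by (simp add: D_def take_Suc_conv_app_nth)
    have "Suc (Max ((!) (D (take k C)) ` preds (C ! k))) \<le> lvl k" if "preds (C ! k) \<noteq> {}"
    proof -
      have "D (take k C) ! h < lvl k" if "h \<in> preds (C ! k)" for h
        using IH[of h] lvl[OF k that] sub that by auto
      then show ?thesis using that fin by (simp add: Suc_le_eq)
    qed
    then show ?case
      using IH len by (auto simp: step nth_append less_Suc_eq)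
  qed
  from this[of "length C"] have "length (D C) = length C" "\<forall>j<length C. D C ! j \<le> lvl j"
    by simp_all
  then show ?thesis
    using bound by (fastforce simp: gate_depths_def D_def[symmetric] in_set_conv_nth)
qed

section \<open>Disjunctions of conjunctions of clauses\<close>

text \<open>On inputs of length \<open>n\<close> the clauses are numbered by \<open>3n\<close>: the literals \<open>X\<^sub>g\<close>, the literals
  \<open>\<not> X\<^sub>g\<close>, and \<open>\<not> X\<^sub>g \<or> \<not> X\<^sub>g\<^sub>+\<^sub>1\<close> (with the second disjunct dropped at the last position).\<close>

definition clause :: "bool list \<Rightarrow> nat \<Rightarrow> bool" where
  "clause X g = (let n = length X in
     if g < n then X ! g
     else if g < 2 * n then \<not> X ! (g - n)
     else \<not> X ! (g - 2 * n) \<or> (g + 1 < 3 * n \<and> \<not> X ! (g + 1 - 2 * n)))"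

text \<open>Five layers: inputs, negations, two-literal clauses, one conjunction for each
  \<open>m < n\<close>, and the output gate \<open>4 * n\<close>, which exists even for
  \<open>n = 0\<close>. The first three layers carry the clauses under their own numbers, so
  \<open>T\<close> selects predecessors directly.\<close>

definition clause_gate ::
  "(nat \<Rightarrow> nat \<Rightarrow> nat \<Rightarrow> bool) \<Rightarrow> (nat \<Rightarrow> nat \<Rightarrow> nat \<Rightarrow> nat \<Rightarrow> bool) \<Rightarrow> nat \<Rightarrow> nat \<Rightarrow> nat \<Rightarrow> gate" where
  "clause_gate N T n i g =
     (if g < n then GInput g
      else if g < 2 * n then GNot (g - n)
      else if g < 3 * n then GOr {h. h + n = g \<or> (h + n = g + 1 \<and> h < 2 * n)}
      else if g < 4 * n then GAnd {h. h < 3 * n \<and> T n i (g - 3 * n) h}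
      else GOr {h. 3 * n \<le> h \<and> h < 4 * n \<and> N n i (h - 3 * n)})"

definition clause_circuit ::
  "(nat \<Rightarrow> nat \<Rightarrow> nat \<Rightarrow> bool) \<Rightarrow> (nat \<Rightarrow> nat \<Rightarrow> nat \<Rightarrow> nat \<Rightarrow> bool) \<Rightarrow> nat \<Rightarrow> nat \<Rightarrow> gate list" where
  "clause_circuit N T n i = map (clause_gate N T n i) [0..<4 * n + 1]"

lemma length_clause_circuit [simp]: "length (clause_circuit N T n i) = 4 * n + 1"
  by (simp add: clause_circuit_def)

lemma nth_clause_circuit [simp]:
  "g < 4 * n + 1 \<Longrightarrow> clause_circuit N T n i ! g = clause_gate N T n i g"
  by (simp add: clause_circuit_def del: upt_Suc)

lemma wf_clause_circuit: "wf_circuit n (clause_circuit N T n i)"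
proof -
  have "clause_circuit N T n i \<noteq> []" by (simp add: clause_circuit_def)
  moreover have "preds (clause_gate N T n i g) \<subseteq> {..<g}" if "g < 4 * n + 1" for g
    using that by (auto simp: clause_gate_def split: if_splits)
  moreover have "k < n" if "clause_gate N T n i g = GInput k" for g k
    using that by (auto simp: clause_gate_def split: if_splits)
  ultimately show ?thesis by (auto simp: wf_circuit_def)
qed

lemma depth_clause_circuit: "\<forall>k \<in> set (gate_depths (clause_circuit N T n i)). k \<le> 4"
proof (rule gate_depths_le[OF wf_clause_circuit])
  \<comment> \<open>The layer number serves as the level.\<close>
  let ?lvl = "\<lambda>g. if g < n then 0 else if g < 2 * n then 1 else if g < 3 * n then 2
    else if g < 4 * n then 3 else 4 :: nat"
  show "?lvl h < ?lvl g"
    if "g < length (clause_circuit N T n i)" "h \<in> preds (clause_circuit N T n i ! g)" for g h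
    using that by (auto simp: clause_gate_def split: if_splits)
  show "?lvl g \<le> 4" for g by simp
qed

lemma circuit_value_clause_circuit:
  "circuit_value (clause_circuit N T (length X) i) X \<longleftrightarrow>
     (\<exists>m < length X. N (length X) i m \<and> (\<forall>g < 3 * length X. T (length X) i m g \<longrightarrow> clause X g))"
  (is "_ \<longleftrightarrow> ?rhs")
proof -
  define n where "n = length X"
  define conj where "conj = (\<lambda>m. \<forall>g < 3 * n. T n i m g \<longrightarrow> clause X g)"
  \<comment> \<open>The guess for all gate values, layer by layer, in closed form.\<close>
  define val where "val = (\<lambda>g. if g < 3 * n then clause X g else if g < 4 * n then conj (g - 3 * n)
    else (\<exists>m<n. N n i m \<and> conj m))"
  define v where "v = map val [0..<4 * n + 1]"
  have len: "length v = 4 * n + 1" by (simp add: v_def)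
  have nth: "v ! g = val g" if "g < 4 * n + 1" for g
    using that by (simp add: v_def del: upt_Suc)
  have "v ! g = gate_value X v (clause_gate N T n i g)" if g: "g < 4 * n + 1" for g
  proof -
    consider "g < n" | "n \<le> g" "g < 2 * n" | "2 * n \<le> g" "g < 3 * n"
      | "3 * n \<le> g" "g < 4 * n" | "g = 4 * n"
      using g by linarith
    then show ?thesis
    proof cases
      case 1
      then show ?thesis by (simp add: nth val_def clause_gate_def clause_def n_def)
    next
      case 2
      then have "\<not> g < n" "g < 3 * n" "g - n < n" by auto
      with 2 show ?thesis
        using g by (simp add: nth val_def clause_gate_def clause_def Let_def flip: n_def)
    next
      case 3
      define p where "p = g - 2 * n"
      have p: "g = 2 * n + p" "p < n" using 3 by (auto simp: p_def)
      have lit: "v ! (n + q) \<longleftrightarrow> \<not> X ! q" if "q < n" for q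
        using that by (simp add: nth val_def clause_def Let_def flip: n_def)
      \<comment> \<open>The predecessors are negation gates; the second one is missing exactly when
        \<open>p\<close> is the last position.\<close>
      have "{h. h + n = g \<or> (h + n = g + 1 \<and> h < 2 * n)}
          = {n + p} \<union> (if p + 1 < n then {n + (p + 1)} else {})"
        using p by auto
      then have "gate_value X v (clause_gate N T n i g) \<longleftrightarrow>
          v ! (n + p) \<or> (p + 1 < n \<and> v ! (n + (p + 1)))"
        using 3 by (simp add: clause_gate_def)
      also have "\<dots> \<longleftrightarrow> \<not> X ! p \<or> (p + 1 < n \<and> \<not> X ! (p + 1))"
        using lit[of p] lit[of "p + 1"] p by blast
      also have "\<dots> \<longleftrightarrow> clause X g"
        using p by (simp add: clause_def Let_def flip: n_def)
      finally show ?thesis using 3 g by (simp add: nth val_def)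
    next
      case 4
      then show ?thesis using g by (auto simp: nth val_def clause_gate_def conj_def)
    next
      case 5
      have "(\<exists>h. 3 * n \<le> h \<and> h < 4 * n \<and> N n i (h - 3 * n) \<and> v ! h) \<longleftrightarrow> (\<exists>m<n. N n i m \<and> conj m)"
        (is "?l \<longleftrightarrow> ?r")
      proof
        assume ?l
        then obtain h where "3 * n \<le> h" "h < 4 * n" "N n i (h - 3 * n)" "v ! h" by blast
        then show ?r by (intro exI[of _ "h - 3 * n"]) (auto simp: nth val_def)
      next
        assume ?r
        then obtain m where "m < n" "N n i m" "conj m" by blast
        then show ?l by (intro exI[of _ "3 * n + m"]) (auto simp: nth val_def)
      qed
      then show ?thesis using 5 by (auto simp: nth val_def clause_gate_def)
    qed
  qed
  then have "foldl (\<lambda>v g. v @ [gate_value X v g]) [] (clause_circuit N T n i) = v"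
    by (intro foldl_gate_value_eqI[OF wf_clause_circuit]) (simp_all add: len)
  then have "circuit_value (clause_circuit N T n i) X = last v"
    by (simp add: circuit_value_def)
  also have "\<dots> = v ! (4 * n)"
    using len by (subst last_conv_nth) auto
  also have "\<dots> = ?rhs"
    by (simp add: nth val_def conj_def n_def)
  finally show ?thesis by (simp add: n_def)
qed

text \<open>Each connection relation is a case distinction on layers given by linear inequalities.
  Terms have no subtraction, so the shifted arguments \<open>g - 3 * n\<close> and
  \<open>h - 3 * n\<close> of \<open>T\<close> and \<open>N\<close> are named by a bounded
  quantifier.\<close>

lemma uniform_clause_circuit:
  assumes N: "bounded_definable (\<lambda>n i m h. N n i m)" and T: "bounded_definable T"
  shows "uniform_family (clause_circuit N T)"
proof -
  note N' = definable_third_argument[OF N, of 4, simplified]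
    and T' = definable_third_argument[OF T, of 4, simplified]
  have eqs:
    "(\<lambda>n i g h. g < length (clause_circuit N T n i)) = (\<lambda>n i g h. g < 4 * n + 1)"
    "(\<lambda>n i g h. g < length (clause_circuit N T n i) \<and> clause_circuit N T n i ! g = GInput h) =
     (\<lambda>n i g h. g < n \<and> h = g)"
    "(\<lambda>n i g h. g < length (clause_circuit N T n i) \<and> clause_circuit N T n i ! g = GNot h) =
     (\<lambda>n i g h. n \<le> g \<and> g < 2 * n \<and> h + n = g)"
    "(\<lambda>n i g h. g < length (clause_circuit N T n i) \<and> (\<exists>S. clause_circuit N T n i ! g = GAnd S)) =
     (\<lambda>n i g h. 3 * n \<le> g \<and> g < 4 * n)"
    "(\<lambda>n i g h. g < length (clause_circuit N T n i) \<and> (\<exists>S. clause_circuit N T n i ! g = GOr S)) =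
     (\<lambda>n i g h. (2 * n \<le> g \<and> g < 3 * n) \<or> g = 4 * n)"
    by (intro ext; auto simp: clause_gate_def split: if_splits)+
  have preds:
    "(\<lambda>n i g h. g < length (clause_circuit N T n i) \<and> h \<in> preds (clause_circuit N T n i ! g)) =
     (\<lambda>n i g h. (n \<le> g \<and> g < 2 * n \<and> h + n = g) \<or>
        (2 * n \<le> g \<and> g < 3 * n \<and> (h + n = g \<or> (h + n = g + 1 \<and> h < 2 * n))) \<or>
        (3 * n \<le> g \<and> g < 4 * n \<and> h < 3 * n \<and> (\<exists>a\<le>g. g = 3 * n + a \<and> T n i a h)) \<or>
        (g = 4 * n \<and> 3 * n \<le> h \<and> h < 4 * n \<and> (\<exists>a\<le>h. h = 3 * n + a \<and> N n i a)))"
    (is "?A = ?B")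
  proof (intro ext)
    fix n i g h
    have sub: "(\<exists>a\<le>k. k = 3 * n + a \<and> P a) \<longleftrightarrow> P (k - 3 * n)" if "3 * n \<le> k"
      for k :: nat and P
      using that by (metis diff_add_inverse diff_le_self le_add_diff_inverse)
    show "?A n i g h = ?B n i g h"
      using sub[of g "\<lambda>a. T n i a h"] sub[of h "\<lambda>a. N n i a"]
      by (auto simp: clause_gate_def split: if_splits)
  qed
  \<comment> \<open>Variable 4 is the first one not occupied by the arguments of the
    relation.\<close>
  have T3: "definable (\<lambda>e. \<exists>a \<le> e 2. e 2 = 3 * e 0 + a \<and> T (e 0) (e 1) a (e 3))"
    by (rule definable_bex[where x = 4]) (intro definable_intros T' | simp)+
  have N3: "definable (\<lambda>e. \<exists>a \<le> e 3. e 3 = 3 * e 0 + a \<and> N (e 0) (e 1) a)"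
    by (rule definable_bex[where x = 4]) (intro definable_intros N' | simp)+
  show ?thesis
    unfolding uniform_family_def eqs preds bounded_definable_iff
    by (intro conjI definable_intros T3 N3)
qed

lemma uniform_AC0_clausesI:
  assumes "bounded_definable (\<lambda>n i m h. N n i m)" "bounded_definable T"
    and "\<And>i X. R i X \<longleftrightarrow> (\<exists>m < length X. N (length X) i m \<and>
           (\<forall>g < 3 * length X. T (length X) i m g \<longrightarrow> clause X g))"
  shows "uniform_AC0 R"
proof -
  \<comment> \<open>For \<open>n + i\<close> at least 2 the power alone dominates, since
    \<open>2 ^ 4 * (n + i)\<close> is at most \<open>(n + i) ^ 5\<close>. Otherwise there are at
    most five gates, which the additive constant covers.\<close>
  have "4 * n + 1 \<le> (n + i) ^ 5 + 5" for n i :: nat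
  proof (cases "n + i \<le> 1")
    case False
    then have "2 ^ 4 \<le> (n + i) ^ 4" by (intro power_mono) auto
    then have "2 ^ 4 * (n + i) \<le> (n + i) ^ 4 * (n + i)" by (rule mult_right_mono) simp
    also have "\<dots> = (n + i) ^ 5" by (simp add: eval_nat_numeral)
    finally show ?thesis by simp
  qed auto
  then show ?thesis
    unfolding uniform_AC0_def
    using uniform_clause_circuit[OF assms(1,2)] wf_clause_circuit depth_clause_circuit assms(3)
    by (intro exI[of _ "clause_circuit N T"] exI[of _ 5] exI[of _ 4])
      (simp add: circuit_value_clause_circuit)
qed

section \<open>Parsing the unary header\<close>

text \<open>Without any \<open>False\<close> this is the full length, so
  \<open>ones X < length X\<close> expresses that the header is terminated.\<close>

definition ones :: "bool list \<Rightarrow> nat" where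
  "ones X = length (takeWhile id X)"

lemma ones_unary [simp]: "ones (replicate m True @ False # Y) = m"
  unfolding ones_def by (induction m) auto

text \<open>A candidate header length is verified by a conjunction of literals, so a circuit can
  test all candidates in parallel instead of counting.\<close>

lemma ones_eq_iff:
  assumes "m < length X"
  shows "(\<forall>k<m. X ! k) \<and> \<not> X ! m \<longleftrightarrow> ones X = m"
proof
  assume "(\<forall>k<m. X ! k) \<and> \<not> X ! m"
  then have "take m X = replicate m True" "\<not> X ! m"
    using assms by (auto simp: list_eq_iff_nth_eq)
  then have "X = replicate m True @ False # drop (Suc m) X"
    using id_take_nth_drop[OF assms] by simp
  then show "ones X = m" by (metis ones_unary)
next
  assume m: "ones X = m"
  then have "\<not> X ! m" using assms nth_length_takeWhile[of id X] by (simp add: ones_def)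
  moreover have "X ! k" if "k < m" for k
    using that m nth_mem[of k "takeWhile id X"] takeWhile_nth[of k id X]
    by (auto simp: ones_def dest!: set_takeWhileD)
  ultimately show "(\<forall>k<m. X ! k) \<and> \<not> X ! m" by blast
qed

lemma split_at_ones:
  assumes "ones X < length X"
  shows "X = replicate (ones X) True @ False # drop (ones X + 1) X"
proof -
  have "(\<forall>k<ones X. X ! k) \<and> \<not> X ! ones X" using ones_eq_iff[OF assms] by blast
  then have "take (ones X) X = replicate (ones X) True" "\<not> X ! ones X"
    using assms by (auto simp: list_eq_iff_nth_eq)
  then show ?thesis using id_take_nth_drop[OF assms] by simp
qed

lemma clause_simps:
  "g < length X \<Longrightarrow> clause X g \<longleftrightarrow> X ! g"
  "g < length X \<Longrightarrow> clause X (length X + g) \<longleftrightarrow> \<not> X ! g"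
  "g + 1 < length X \<Longrightarrow> clause X (2 * length X + g) \<longleftrightarrow> \<not> (X ! g \<and> X ! (g + 1))"
  by (auto simp: clause_def Let_def)

text \<open>The disjunction over \<open>m\<close> tries all header lengths, and the header clauses
  leave only \<open>m = ones X\<close>. Hence \<open>N\<close> and \<open>E\<close> can use the
  header length as a plain number.\<close>

lemma uniform_AC0_headerI:
  assumes N: "bounded_definable (\<lambda>n i m h. N n i m)" and E: "bounded_definable E"
    and R: "\<And>i X. R i X \<longleftrightarrow> ones X < length X \<and> N (length X) i (ones X) \<and>
           (\<forall>g < 3 * length X. E (length X) i (ones X) g \<longrightarrow> clause X g)"
  shows "uniform_AC0 R"
proof (rule uniform_AC0_clausesI[OF N])
  \<comment> \<open>Clauses below \<open>m\<close> are the positive literals of the header; clause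
    \<open>n + m\<close> is the negated literal of its terminator.\<close>
  let ?T = "\<lambda>n i m g. g < m \<or> g = n + m \<or> E n i m g"
  show "bounded_definable ?T"
    using E unfolding bounded_definable_iff by (intro definable_intros)
  have header: "(\<forall>g < 3 * length X. ?T (length X) i m g \<longrightarrow> clause X g) \<longleftrightarrow>
      ones X = m \<and> (\<forall>g < 3 * length X. E (length X) i m g \<longrightarrow> clause X g)"
    if m: "m < length X" for i m X
  proof -
    have "(\<forall>g < 3 * length X. g < m \<or> g = length X + m \<longrightarrow> clause X g) \<longleftrightarrow>
        (\<forall>g<m. clause X g) \<and> clause X (length X + m)"
      (is "?l \<longleftrightarrow> ?r")
    proof
      assume l: ?l
      have "length X + m < 3 * length X" using m by simp
      moreover have "g < 3 * length X" if "g < m" for g using that m by simp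
      ultimately show ?r using l by blast
    qed auto
    also have "\<dots> \<longleftrightarrow> (\<forall>g<m. X ! g) \<and> \<not> X ! m"
      using m by (auto simp: clause_simps)
    also have "\<dots> \<longleftrightarrow> ones X = m" by (rule ones_eq_iff[OF m])
    finally show ?thesis by blast
  qed
  show "R i X \<longleftrightarrow> (\<exists>m < length X. N (length X) i m \<and>
      (\<forall>g < 3 * length X. ?T (length X) i m g \<longrightarrow> clause X g))" for i X
    unfolding R using header by blast
qed

section \<open>Concatenations of two-bit blocks\<close>

lemma length_concat_pairs [simp]: "length (concat (map (\<lambda>x. [f x, g x]) xs)) = 2 * length xs"
  by (induction xs) auto

lemma nth_concat_pairs:
  "k < 2 * length xs \<Longrightarrow> concat (map (\<lambda>x. [f x, g x]) xs) ! k =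
     (if even k then f (xs ! (k div 2)) else g (xs ! (k div 2)))"
proof (induction xs arbitrary: k)
  case (Cons x xs)
  show ?case
  proof (cases "k < 2")
    case True
    then show ?thesis by (auto simp: less_2_cases_iff)
  next
    case False
    then obtain j where j: "k = j + 2" by (metis add.commute le_Suc_ex not_less)
    with Cons show ?thesis by simp
  qed
qed simp

section \<open>Transporting values along comparator homomorphisms\<close>

definition map_instance :: "('u \<Rightarrow> 'v) \<Rightarrow> 'u ccv_instance \<Rightarrow> 'v ccv_instance" where
  "map_instance f I = \<lparr>wires = wires I, gates = gates I, inputs = map f (inputs I),
     designated = designated I\<rparr>"

lemma map_instance_simps [simp]:
  "wires (map_instance f I) = wires I" "gates (map_instance f I) = gates I"
  "inputs (map_instance f I) = map f (inputs I)" "designated (map_instance f I) = designated I"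
  by (simp_all add: map_instance_def)

lemma valid_map_instance [simp]: "valid_instance (map_instance f I) \<longleftrightarrow> valid_instance I"
  by (simp add: valid_instance_def)

lemma length_fold_comparator [simp]: "length (fold (comparator land lor) gs v) = length v"
  by (induction gs arbitrary: v) (auto simp: comparator_def)

text \<open>A homomorphism for both connectives commutes with every single gate. The index bounds
  let \<open>nth\<close> pass through \<open>map\<close>, and they persist because gates preserve
  the length.\<close>

lemma fold_comparator_map:
  assumes "\<And>p q. f (land p q) = land' (f p) (f q)" "\<And>p q. f (lor p q) = lor' (f p) (f q)"
    and "\<forall>(a, b) \<in> set gs. a < length v \<and> b < length v"
  shows "fold (comparator land' lor') gs (map f v) = map f (fold (comparator land lor) gs v)"
  using assms(3)
proof (induction gs arbitrary: v)
  case (Cons ab gs)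
  have "comparator land' lor' ab (map f v) = map f (comparator land lor ab v)"
    using Cons.prems by (auto simp: comparator_def assms(1,2) map_update)
  moreover have "length (comparator land lor ab v) = length v"
    by (auto simp: comparator_def split: prod.split)
  ultimately show ?case using Cons by simp
qed simp

lemma circuit_output_map_instance:
  assumes "\<And>p q. f (land p q) = land' (f p) (f q)" "\<And>p q. f (lor p q) = lor' (f p) (f q)"
    and "valid_instance I"
  shows "circuit_output land' lor' (map_instance f I) = f (circuit_output land lor I)"
proof -
  have "\<forall>(a, b) \<in> set (gates I). a < length (inputs I) \<and> b < length (inputs I)"
    and "designated I < length (inputs I)"
    using assms(3) by (auto simp: valid_instance_def)
  then show ?thesis
    unfolding circuit_output_def by (simp add: fold_comparator_map[where land = land and lor = lor] assms(1,2))
qed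

definition three_of_bool :: "bool \<Rightarrow> three" where
  "three_of_bool b = (if b then One else Zero)"

lemma output_threshold:
  "valid_instance I \<Longrightarrow> circuit_output (\<and>) (\<or>) (map_instance (\<lambda>p. p = One) I) \<longleftrightarrow>
     circuit_output three_and three_or I = One"
  by (rule circuit_output_map_instance[where f = "\<lambda>p. p = One"])
    (auto simp: three_and_def three_or_def)

lemma output_embed:
  "valid_instance I \<Longrightarrow> circuit_output three_and three_or (map_instance three_of_bool I) =
     three_of_bool (circuit_output (\<and>) (\<or>) I)"
  by (rule circuit_output_map_instance)
    (auto simp: three_and_def three_or_def three_of_bool_def)

section \<open>Unique parsing of encoded instances\<close>

definition encode_wiring :: "nat \<Rightarrow> nat \<Rightarrow> (nat \<times> nat) list \<Rightarrow> bool list" where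
  "encode_wiring m d gs =
     one_hot m d @ concat (map (\<lambda>(a, b). one_hot m a @ one_hot m b) gs)"

text \<open>Separates the tail that does not depend on the type of values; both reductions copy it
  verbatim.\<close>

lemma encode_instance_eq:
  "encode_instance enc I = replicate (wires I) True @ False #
     concat (map enc (inputs I)) @ encode_wiring (wires I) (designated I) (gates I)"
  by (simp add: encode_instance_def encode_wiring_def)

lemma encode_bool_eq: "concat (map encode_bool xs) = xs"
  by (induction xs) auto

text \<open>The second bit of a code is the threshold value, so thresholding a string just keeps the
  second bit of each block.\<close>

lemma encode_three_eq: "encode_three = (\<lambda>p. [p = Star, p = One])"
  by (rule ext, rename_tac p, case_tac p) auto

lemma inj_encode_three:
  "concat (map encode_three ps) = concat (map encode_three qs) \<Longrightarrow> ps = qs"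
proof (induction ps arbitrary: qs)
  case Nil
  then show ?case by (cases qs) (auto simp: encode_three_eq)
next
  case (Cons p ps)
  then obtain q qs' where qs: "qs = q # qs'" by (cases qs) (auto simp: encode_three_eq)
  with Cons show ?case by (cases p; cases q) auto
qed

lemma unary_header_eq:
  "replicate m True @ False # Y = replicate m' True @ False # Y' \<longleftrightarrow> m = m' \<and> Y = Y'"
  by (metis append_same_eq list.inject ones_unary same_append_eq)

section \<open>The reduction from Boolean to three-valued circuits\<close>

text \<open>The length test ensures that the terminator and all input bits are present. Otherwise
  the result is \<open>[]\<close>, which encodes no instance. The tail is copied unchecked: it is
  correct for one problem iff it is correct for the other.\<close>

definition to_three :: "bool list \<Rightarrow> bool list" where
  "to_three X = (let m = ones X in
     if 2 * m + 1 \<le> length X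
     then replicate m True @ False #
       concat (map (\<lambda>b. [False, b]) (take m (drop (m + 1) X))) @ drop (2 * m + 1) X
     else [])"

lemma length_to_three:
  "length (to_three X) = (if 2 * ones X + 1 \<le> length X then length X + ones X else 0)"
  by (auto simp: to_three_def Let_def)

lemma to_three_unary:
  assumes "length ys = m"
  shows "to_three (replicate m True @ False # ys @ Z) =
    replicate m True @ False # concat (map encode_three (map three_of_bool ys)) @ Z"
proof -
  have "encode_three (three_of_bool b) = [False, b]" for b by (simp add: three_of_bool_def)
  then show ?thesis using assms by (simp add: to_three_def Let_def comp_def)
qed

text \<open>The converse must decode an arbitrary \<open>X\<close>: its image has only codes of 0
  and 1 in the input part, so the instance encoded by the image comes from a Boolean one.\<close>

lemma to_three_correct: "X \<in> CCV \<longleftrightarrow> to_three X \<in> Three_valued_CCV"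
proof
  assume "X \<in> CCV"
  then obtain I where I: "valid_instance I" "circuit_output (\<and>) (\<or>) I"
    and X: "X = encode_instance encode_bool I"
    by (auto simp: CCV_def)
  have "to_three X = encode_instance encode_three (map_instance three_of_bool I)"
    using I(1) unfolding X encode_instance_eq encode_bool_eq
    by (subst to_three_unary) (auto simp: valid_instance_def)
  then show "to_three X \<in> Three_valued_CCV"
    using I output_embed[OF I(1)]
    by (auto simp: Three_valued_CCV_def three_of_bool_def intro!: exI[of _ "map_instance three_of_bool I"])
next
  assume "to_three X \<in> Three_valued_CCV"
  then obtain J where J: "valid_instance J" "circuit_output three_and three_or J = One"
    and FX: "to_three X = encode_instance encode_three J"
    by (auto simp: Three_valued_CCV_def)
  define m where "m = ones X"
  define ys where "ys = take m (drop (m + 1) X)"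
  define Z where "Z = drop (2 * m + 1) X"
  \<comment> \<open>Every encoding contains the terminator of its header, so the default branch is
    excluded.\<close>
  have "to_three X \<noteq> []" by (simp add: FX encode_instance_eq)
  then have len: "2 * m + 1 \<le> length X" by (auto simp: to_three_def m_def Let_def split: if_splits)
  then have ys: "length ys = m" by (simp add: ys_def)
  have "drop (m + 1) X = ys @ Z"
    using append_take_drop_id[of m "drop (m + 1) X"] by (simp add: ys_def Z_def mult_2)
  then have X: "X = replicate m True @ False # ys @ Z"
    using split_at_ones[of X] len by (simp add: m_def)
  have eq: "wires J = m" "concat (map encode_three (map three_of_bool ys)) @ Z =
      concat (map encode_three (inputs J)) @ encode_wiring m (designated J) (gates J)"
    using FX unfolding X to_three_unary[OF ys] encode_instance_eq unary_header_eq by auto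
  moreover have "length (inputs J) = m" using J(1) eq(1) by (simp add: valid_instance_def)
  \<comment> \<open>Both input parts have length \<open>2 * m\<close>, so the two sides split at the
    same place.\<close>
  ultimately have "concat (map encode_three (map three_of_bool ys)) = concat (map encode_three (inputs J))"
    and Z: "Z = encode_wiring m (designated J) (gates J)"
    using ys by (auto simp: encode_three_eq simp del: map_map)
  from inj_encode_three[OF this(1)] have ins: "inputs J = map three_of_bool ys" by simp
  define I where "I = \<lparr>wires = m, gates = gates J, inputs = ys, designated = designated J\<rparr>"
  have JI: "J = map_instance three_of_bool I"
    by (simp add: I_def map_instance_def eq(1) flip: ins)
  have valid: "valid_instance I" using J(1) by (simp add: JI)
  then have "circuit_output (\<and>) (\<or>) I"
    using J(2) output_embed[OF valid] by (auto simp: JI three_of_bool_def split: if_splits)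
  moreover have "X = encode_instance encode_bool I"
    by (simp only: encode_instance_eq encode_bool_eq) (simp add: X Z I_def)
  ultimately show "X \<in> CCV" using valid by (auto simp: CCV_def)
qed

text \<open>Bit \<open>j\<close> of the input part sits at \<open>m + 1 + j\<close> in
  \<open>X\<close> and moves to \<open>i = m + 2 + 2 * j\<close>, whence the source
  \<open>(i + m) div 2\<close>; odd \<open>i + m\<close> are the inserted zeros. The tail moves by
  \<open>m\<close>. The form as a conjunction of implications matches the clause circuits.\<close>

lemma nth_to_three:
  assumes len: "2 * ones X + 1 \<le> length X" and i: "i < length X + ones X"
  shows "to_three X ! i \<longleftrightarrow> i \<noteq> ones X \<and>
    (ones X < i \<and> i < 3 * ones X + 1 \<longrightarrow> even (i + ones X) \<and> X ! ((i + ones X) div 2)) \<and>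
    (3 * ones X + 1 \<le> i \<longrightarrow> X ! (i - ones X))"
proof -
  define m where "m = ones X"
  define ys where "ys = take m (drop (m + 1) X)"
  have ys: "length ys = m" using len by (simp add: ys_def m_def)
  have F: "to_three X = replicate m True @ False # concat (map (\<lambda>b. [False, b]) ys) @ drop (2 * m + 1) X"
    using len by (simp add: to_three_def ys_def m_def Let_def)
  consider "i < m" | "i = m" | "m < i" "i < 3 * m + 1" | "3 * m + 1 \<le> i" by linarith
  then show ?thesis unfolding m_def[symmetric]
  proof cases
    case 3
    define k where "k = i - m - 1"
    have k: "i = m + 1 + k" "k < 2 * m" using 3 by (auto simp: k_def)
    have "to_three X ! i = concat (map (\<lambda>b. [False, b]) ys) ! k"
      using k ys by (simp add: F nth_append)
    also have "\<dots> \<longleftrightarrow> odd k \<and> ys ! (k div 2)"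
      using k ys by (subst nth_concat_pairs) auto
    also have "\<dots> \<longleftrightarrow> even (i + m) \<and> X ! ((i + m) div 2)"
    proof (cases "odd k")
      case True
      then obtain j where "k = 2 * j + 1" by (auto elim: oddE)
      then show ?thesis using k len by (simp add: ys_def m_def)
    qed (simp add: k)
    finally show "to_three X ! i \<longleftrightarrow> i \<noteq> m \<and>
      (m < i \<and> i < 3 * m + 1 \<longrightarrow> even (i + m) \<and> X ! ((i + m) div 2)) \<and>
      (3 * m + 1 \<le> i \<longrightarrow> X ! (i - m))"
      using 3 by auto
  next
    case 4
    then obtain k where k: "i = 3 * m + 1 + k" using le_Suc_ex by blast
    then show "to_three X ! i \<longleftrightarrow> i \<noteq> m \<and>
      (m < i \<and> i < 3 * m + 1 \<longrightarrow> even (i + m) \<and> X ! ((i + m) div 2)) \<and>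
      (3 * m + 1 \<le> i \<longrightarrow> X ! (i - m))"
      using ys i len by (simp add: F nth_append m_def add.commute)
  qed (auto simp: F nth_append)
qed

lemma AC0_to_three: "AC0_function to_three"
proof -
  have two: "2 * n \<le> n ^ 2 + 2" for n :: nat
  proof (cases "n < 2")
    case False
    then have "2 * n \<le> n * n" by (intro mult_right_mono) auto
    then show ?thesis unfolding power2_eq_square by linarith
  qed auto
  have "length (to_three X) \<le> length X ^ 2 + 2" for X
    using two[of "length X"] by (auto simp: length_to_three)
  moreover have "uniform_AC0 (\<lambda>i X. i < length (to_three X))"
  proof (rule uniform_AC0_headerI)
    show "bounded_definable (\<lambda>n i m h. 2 * m + 1 \<le> n \<and> i < n + m)"
      \<comment> \<open>The length depends only on \<open>n\<close> and \<open>ones X\<close>, so no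
        clauses beyond the header are needed.\<close>
      and "bounded_definable (\<lambda>n i m h. False)"
      unfolding bounded_definable_iff by (intro definable_intros)+
  qed (auto simp: length_to_three)
  moreover have "uniform_AC0 (\<lambda>i X. i < length (to_three X) \<and> to_three X ! i)"
  proof (rule uniform_AC0_headerI)
    have "definable (\<lambda>e. \<exists>k \<le> e 1 + e 2. 2 * k = e 1 + e 2)"
      by (rule definable_bex[where x = 4]) (intro definable_intros | simp)+
    then show "bounded_definable (\<lambda>n i m h. 2 * m + 1 \<le> n \<and> i < n + m \<and> i \<noteq> m \<and>
        (m < i \<and> i < 3 * m + 1 \<longrightarrow> (\<exists>k \<le> i + m. 2 * k = i + m)))"
      unfolding bounded_definable_iff by (intro definable_intros)
    \<comment> \<open>Relation \<open>E\<close> selects the source position \<open>g\<close>,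
      written without division or subtraction; parity and all other purely numerical conditions
      belong to \<open>N\<close>.\<close>
    show "bounded_definable (\<lambda>n i m g. (m < i \<and> i < 3 * m + 1 \<and> 2 * g = i + m) \<or>
        (3 * m + 1 \<le> i \<and> g + m = i))"
      unfolding bounded_definable_iff by (intro definable_intros)
    fix i :: nat and X :: "bool list"
    define m where "m = ones X"
    define n where "n = length X"
    have ev: "(\<exists>k \<le> i + m. 2 * k = i + m) \<longleftrightarrow> even (i + m)"
      by (metis dvd_def dvd_triv_left le_add2 mult_2)
    \<comment> \<open>In either region one \<open>g\<close> is selected. It lies below
      \<open>n\<close>, so its clause is a positive literal.\<close>
    have "(\<forall>g < 3 * n. (m < i \<and> i < 3 * m + 1 \<and> 2 * g = i + m) \<or> (3 * m + 1 \<le> i \<and> g + m = i)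
          \<longrightarrow> clause X g) \<longleftrightarrow>
        (m < i \<and> i < 3 * m + 1 \<longrightarrow> X ! ((i + m) div 2)) \<and> (3 * m + 1 \<le> i \<longrightarrow> X ! (i - m))"
      if "2 * m + 1 \<le> n" "i < n + m" "m < i \<and> i < 3 * m + 1 \<longrightarrow> even (i + m)"
    proof (cases "3 * m + 1 \<le> i")
      case True
      then obtain k where k: "i = k + m" using that[of "i - m"] by simp
      with that have "k < length X" by (simp add: n_def)
      then show ?thesis using True k by (auto simp: clause_simps n_def)
    next
      case False
      show ?thesis
      proof (cases "m < i")
        case True
        with False that(3) have "even (i + m)" by simp
        then obtain k where k: "i + m = 2 * k" by (rule evenE)
        with False that True have "k < length X" by (simp add: n_def)
        then show ?thesis using True False k by (auto simp: clause_simps n_def)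
      qed (use False in auto)
    qed
    then show "i < length (to_three X) \<and> to_three X ! i \<longleftrightarrow>
       ones X < length X \<and>
       (2 * ones X + 1 \<le> length X \<and> i < length X + ones X \<and> i \<noteq> ones X \<and>
        (ones X < i \<and> i < 3 * ones X + 1 \<longrightarrow> (\<exists>k \<le> i + ones X. 2 * k = i + ones X))) \<and>
       (\<forall>g < 3 * length X. (ones X < i \<and> i < 3 * ones X + 1 \<and> 2 * g = i + ones X) \<or>
          (3 * ones X + 1 \<le> i \<and> g + ones X = i) \<longrightarrow> clause X g)"
      using nth_to_three[of X i] ev
      unfolding m_def n_def length_to_three by (auto split: if_splits)
  qed
  ultimately show ?thesis unfolding AC0_function_def by blast
qed

section \<open>The reduction from three-valued to Boolean circuits\<close>

text \<open>A block \<open>11\<close> must be rejected explicitly: keeping second bits would read it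
  as 1 and could turn a malformed string into a member of \<open>CCV\<close>.\<close>

definition well_coded :: "bool list \<Rightarrow> bool" where
  "well_coded X \<longleftrightarrow> 3 * ones X + 1 \<le> length X \<and>
     (\<forall>k < ones X. \<not> (X ! (ones X + 1 + 2 * k) \<and> X ! (ones X + 1 + 2 * k + 1)))"

definition to_bool :: "bool list \<Rightarrow> bool list" where
  "to_bool X = (if well_coded X
     then replicate (ones X) True @ False #
       map (\<lambda>k. X ! (ones X + 1 + 2 * k + 1)) [0..<ones X] @ drop (3 * ones X + 1) X
     else [])"

lemma length_to_bool: "length (to_bool X) = (if well_coded X then length X - ones X else 0)"
  by (auto simp: to_bool_def well_coded_def)

lemma nth_pair_unary:
  assumes "k < length ps"
  shows "(replicate m True @ False # concat (map encode_three ps) @ Z) ! (m + 1 + 2 * k) \<longleftrightarrow> ps ! k = Star"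
    and "(replicate m True @ False # concat (map encode_three ps) @ Z) ! (m + 1 + 2 * k + 1) \<longleftrightarrow> ps ! k = One"
  using assms by (simp_all add: encode_three_eq nth_append nth_concat_pairs)

lemma to_bool_unary:
  assumes "length ps = m"
  shows "to_bool (replicate m True @ False # concat (map encode_three ps) @ Z) =
    replicate m True @ False # map (\<lambda>p. p = One) ps @ Z"
proof -
  let ?X = "replicate m True @ False # concat (map encode_three ps) @ Z"
  have len: "length (concat (map encode_three ps)) = 2 * m"
    using assms by (simp add: encode_three_eq)
  have "well_coded ?X"
    using nth_pair_unary[of _ ps m Z] assms len by (auto simp: well_coded_def)
  moreover have "map (\<lambda>k. ?X ! (m + 1 + 2 * k + 1)) [0..<m] = map (\<lambda>p. p = One) ps"
    using nth_pair_unary(2)[of _ ps m Z] assms by (auto simp: list_eq_iff_nth_eq)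
  moreover have "drop (3 * m + 1) ?X = Z" using len by simp
  ultimately show ?thesis unfolding to_bool_def ones_unary by simp
qed

text \<open>With \<open>11\<close> excluded, every block is the code of some value.\<close>

lemma well_coded_decode:
  assumes "well_coded X"
  obtains m ps Z where "X = replicate m True @ False # concat (map encode_three ps) @ Z" "length ps = m"
proof -
  define m where "m = ones X"
  define d where "d = (\<lambda>k. if X ! (m + 1 + 2 * k + 1) then One else if X ! (m + 1 + 2 * k) then Star else Zero)"
  define ps where "ps = map d [0..<m]"
  have len: "3 * m + 1 \<le> length X" using assms by (simp add: well_coded_def m_def)
  have "concat (map encode_three ps) ! j = take (2 * m) (drop (m + 1) X) ! j" if "j < 2 * m" for j
  proof -
    have "j div 2 < m" using that by auto
    then have d: "ps ! (j div 2) = d (j div 2)" by (simp add: ps_def)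
    have wc: "\<not> (X ! (m + 1 + 2 * (j div 2)) \<and> X ! (m + 1 + 2 * (j div 2) + 1))"
      using assms \<open>j div 2 < m\<close> by (auto simp: well_coded_def m_def)
    have "concat (map encode_three ps) ! j \<longleftrightarrow>
        (if even j then d (j div 2) = Star else d (j div 2) = One)"
      using that unfolding encode_three_eq
      by (subst nth_concat_pairs) (simp_all add: d, simp add: ps_def)
    also have "\<dots> \<longleftrightarrow> X ! (m + 1 + j)"
    proof (cases "even j")
      case True
      then have "2 * (j div 2) = j" by simp
      \<comment> \<open>Decoding tests the second bit first; \<open>wc\<close> makes a set first bit
        imply that the second bit is 0.\<close>
      with wc True show ?thesis by (auto simp: d_def)
    next
      case False
      then have "m + 1 + 2 * (j div 2) + 1 = m + 1 + j" by simp
      then have "d (j div 2) = One \<longleftrightarrow> X ! (m + 1 + j)" unfolding d_def by (simp only:) simp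
      with False show ?thesis by simp
    qed
    finally show ?thesis using that len by simp
  qed
  moreover have "length (concat (map encode_three ps)) = 2 * m"
    unfolding encode_three_eq length_concat_pairs by (simp add: ps_def)
  ultimately have "concat (map encode_three ps) = take (2 * m) (drop (m + 1) X)"
    using len by (intro nth_equalityI) simp_all
  then have "drop (m + 1) X = concat (map encode_three ps) @ drop (2 * m) (drop (m + 1) X)"
    by (simp only: append_take_drop_id)
  moreover have "X = replicate m True @ False # drop (m + 1) X"
    using split_at_ones[of X] len by (simp add: m_def)
  ultimately have "X = replicate m True @ False # concat (map encode_three ps) @ drop (2 * m) (drop (m + 1) X)"
    by (simp only:)
  moreover have "length ps = m" by (simp add: ps_def)
  ultimately show ?thesis using that by blast
qed

text \<open>Thresholding is not injective, so in the converse the inputs are decoded from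
  \<open>X\<close> itself and only the wiring is read off the Boolean instance.\<close>

lemma to_bool_correct: "X \<in> Three_valued_CCV \<longleftrightarrow> to_bool X \<in> CCV"
proof
  assume "X \<in> Three_valued_CCV"
  then obtain I where I: "valid_instance I" "circuit_output three_and three_or I = One"
    and X: "X = encode_instance encode_three I"
    by (auto simp: Three_valued_CCV_def)
  have "to_bool X = encode_instance encode_bool (map_instance (\<lambda>p. p = One) I)"
    using I(1) unfolding X encode_instance_eq encode_bool_eq
    by (subst to_bool_unary) (auto simp: valid_instance_def)
  then show "to_bool X \<in> CCV"
    using I output_threshold[OF I(1)]
    by (auto simp: CCV_def intro!: exI[of _ "map_instance (\<lambda>p. p = One) I"])
next
  assume "to_bool X \<in> CCV"
  then obtain J where J: "valid_instance J" "circuit_output (\<and>) (\<or>) J"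
    and FX: "to_bool X = encode_instance encode_bool J"
    by (auto simp: CCV_def)
  have "to_bool X \<noteq> []" by (simp add: FX encode_instance_eq)
  then have "well_coded X" by (auto simp: to_bool_def split: if_splits)
  then obtain m ps Z where X: "X = replicate m True @ False # concat (map encode_three ps) @ Z"
    and ps: "length ps = m"
    by (rule well_coded_decode)
  have eq: "wires J = m" "map (\<lambda>p. p = One) ps @ Z =
      inputs J @ encode_wiring m (designated J) (gates J)"
    using FX unfolding X to_bool_unary[OF ps] encode_instance_eq encode_bool_eq unary_header_eq by auto
  moreover have "length (inputs J) = m" using J(1) eq(1) by (simp add: valid_instance_def)
  ultimately have ins: "map (\<lambda>p. p = One) ps = inputs J"
    and Z: "Z = encode_wiring m (designated J) (gates J)"
    using ps by auto
  define I where "I = \<lparr>wires = m, gates = gates J, inputs = ps, designated = designated J\<rparr>"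
  have JI: "J = map_instance (\<lambda>p. p = One) I"
    by (simp add: I_def map_instance_def eq(1) ins)
  have valid: "valid_instance I" using J(1) by (simp add: JI)
  then have "circuit_output three_and three_or I = One"
    using J(2) output_threshold[OF valid] by (simp add: JI)
  moreover have "X = encode_instance encode_three I"
    by (simp add: encode_instance_eq X Z I_def)
  ultimately show "X \<in> Three_valued_CCV" using valid by (auto simp: Three_valued_CCV_def)
qed

text \<open>Wire \<open>k\<close> has its output bit at \<open>i = m + 1 + k\<close> and its source
  at \<open>m + 1 + 2 * k + 1 = 2 * i - m\<close>; the tail moves back by \<open>m\<close>.\<close>

lemma nth_to_bool:
  assumes wc: "well_coded X" and i: "i + ones X < length X"
  shows "to_bool X ! i \<longleftrightarrow> i \<noteq> ones X \<and>
    (ones X < i \<and> i < 2 * ones X + 1 \<longrightarrow> X ! (2 * i - ones X)) \<and>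
    (2 * ones X + 1 \<le> i \<longrightarrow> X ! (i + ones X))"
proof -
  define m where "m = ones X"
  have len: "3 * m + 1 \<le> length X" using wc by (simp add: well_coded_def m_def)
  have F: "to_bool X = replicate m True @ False #
      map (\<lambda>k. X ! (m + 1 + 2 * k + 1)) [0..<m] @ drop (3 * m + 1) X"
    using wc by (simp add: to_bool_def m_def)
  consider "i < m" | "i = m" | "m < i" "i < 2 * m + 1" | "2 * m + 1 \<le> i" by linarith
  then have "to_bool X ! i \<longleftrightarrow> i \<noteq> m \<and> (m < i \<and> i < 2 * m + 1 \<longrightarrow> X ! (2 * i - m)) \<and>
    (2 * m + 1 \<le> i \<longrightarrow> X ! (i + m))"
  proof cases
    case 3
    define k where "k = i - m - 1"
    have k: "i = m + 1 + k" "k < m" using 3 by (auto simp: k_def)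
    have "2 * i - m = m + 1 + 2 * k + 1" using k by simp
    then show ?thesis using k by (simp add: F nth_append)
  next
    case 4
    then obtain k where k: "i = 2 * m + 1 + k" using le_Suc_ex by blast
    have "to_bool X ! i = drop (3 * m + 1) X ! k" by (simp add: F k nth_append)
    also have "\<dots> = X ! (3 * m + 1 + k)" using len by (intro nth_drop)
    also have "3 * m + 1 + k = i + m" using k by simp
    finally show ?thesis using k by simp
  qed (auto simp: F nth_append)
  then show ?thesis by (simp add: m_def)
qed

text \<open>Rejecting \<open>11\<close> on wire \<open>k\<close> is one two-literal clause, numbered
  by the first position of its block shifted by \<open>2 * length X\<close>. The condition on
  lengths keeps both positions inside the string.\<close>

lemma well_coded_clauses:
  "well_coded X \<longleftrightarrow> 3 * ones X + 1 \<le> length X \<and>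
     (\<forall>g < 3 * length X. (\<exists>k \<le> ones X. k < ones X \<and> g = 2 * length X + (ones X + 1 + 2 * k))
        \<longrightarrow> clause X g)"
proof -
  have "(\<forall>g < 3 * length X. (\<exists>k \<le> ones X. k < ones X \<and> g = 2 * length X + (ones X + 1 + 2 * k))
        \<longrightarrow> clause X g) \<longleftrightarrow>
      (\<forall>k < ones X. clause X (2 * length X + (ones X + 1 + 2 * k)))"
    if "3 * ones X + 1 \<le> length X"
    using that by fastforce
  moreover have "clause X (2 * length X + (ones X + 1 + 2 * k)) \<longleftrightarrow>
      \<not> (X ! (ones X + 1 + 2 * k) \<and> X ! (ones X + 1 + 2 * k + 1))"
    if "3 * ones X + 1 \<le> length X" "k < ones X" for k
    using that by (intro clause_simps(3)) simp
  ultimately show ?thesis unfolding well_coded_def by blast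
qed

lemma AC0_to_bool: "AC0_function to_bool"
proof -
  let ?P = "\<lambda>n m g. \<exists>k \<le> m. k < m \<and> g = 2 * n + (m + 1 + 2 * k)"
  have P: "definable (\<lambda>e. ?P (e 0) (e 2) (e 3))"
    by (rule definable_bex[where x = 4]) (intro definable_intros | simp)+
  have "length (to_bool X) \<le> length X ^ 1 + 1" for X
    by (auto simp: length_to_bool)
  moreover have "uniform_AC0 (\<lambda>i X. i < length (to_bool X))"
  proof (rule uniform_AC0_headerI)
    show "bounded_definable (\<lambda>n i m h. 3 * m + 1 \<le> n \<and> i + m < n)"
      unfolding bounded_definable_iff by (intro definable_intros)
    \<comment> \<open>Even the length of the result depends on the coding, so the coding clauses
      occur here as well as for the bits.\<close>
    show "bounded_definable (\<lambda>n i m g. ?P n m g)"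
      using P unfolding bounded_definable_iff .
    show "i < length (to_bool X) \<longleftrightarrow> ones X < length X \<and>
        (3 * ones X + 1 \<le> length X \<and> i + ones X < length X) \<and>
        (\<forall>g < 3 * length X. ?P (length X) (ones X) g \<longrightarrow> clause X g)" for i X
      using well_coded_clauses[of X] by (auto simp: length_to_bool)
  qed
  moreover have "uniform_AC0 (\<lambda>i X. i < length (to_bool X) \<and> to_bool X ! i)"
  proof (rule uniform_AC0_headerI)
    show "bounded_definable (\<lambda>n i m h. 3 * m + 1 \<le> n \<and> i + m < n \<and> i \<noteq> m)"
      unfolding bounded_definable_iff by (intro definable_intros)
    \<comment> \<open>The literal at the source position of bit \<open>i\<close>, with the
      subtraction in \<open>2 * i - m\<close> moved to the other side.\<close>
    let ?Q = "\<lambda>i m g. (m < i \<and> i < 2 * m + 1 \<and> g + m = 2 * i) \<or> (2 * m + 1 \<le> i \<and> g = i + m)"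
    show "bounded_definable (\<lambda>n i m g. ?P n m g \<or> ?Q i m g)"
      using P unfolding bounded_definable_iff by (intro definable_intros)
    fix i :: nat and X :: "bool list"
    have Q: "(\<forall>g < 3 * length X. ?Q i (ones X) g \<longrightarrow> clause X g) \<longleftrightarrow>
        (ones X < i \<and> i < 2 * ones X + 1 \<longrightarrow> X ! (2 * i - ones X)) \<and>
        (2 * ones X + 1 \<le> i \<longrightarrow> X ! (i + ones X))"
      if "3 * ones X + 1 \<le> length X" "i + ones X < length X"
    proof -
      have "g + ones X = 2 * i \<longleftrightarrow> g = 2 * i - ones X" if "ones X < i" for g
        using that by linarith
      moreover have "2 * i - ones X < length X" if "i < 2 * ones X + 1"
        using that \<open>3 * ones X + 1 \<le> length X\<close> by linarith
      ultimately show ?thesis using that by (auto simp: clause_simps)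
    qed
    have "(\<forall>g < 3 * length X. ?P (length X) (ones X) g \<or> ?Q i (ones X) g \<longrightarrow> clause X g) \<longleftrightarrow>
        (\<forall>g < 3 * length X. ?P (length X) (ones X) g \<longrightarrow> clause X g) \<and>
        (\<forall>g < 3 * length X. ?Q i (ones X) g \<longrightarrow> clause X g)"
      by blast
    moreover have "i < length (to_bool X) \<longleftrightarrow> well_coded X \<and> i + ones X < length X"
      by (auto simp: length_to_bool)
    moreover have "well_coded X \<Longrightarrow> ones X < length X" by (simp add: well_coded_def)
    ultimately show "i < length (to_bool X) \<and> to_bool X ! i \<longleftrightarrow> ones X < length X \<and>
        (3 * ones X + 1 \<le> length X \<and> i + ones X < length X \<and> i \<noteq> ones X) \<and>
        (\<forall>g < 3 * length X. ?P (length X) (ones X) g \<or> ?Q i (ones X) g \<longrightarrow> clause X g)"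
      using well_coded_clauses[of X] nth_to_bool[of X i] Q by blast
  qed
  ultimately show ?thesis unfolding AC0_function_def by blast
qed

theorem theorem35: "AC0_many_one_equivalent Three_valued_CCV CCV"
  unfolding AC0_many_one_equivalent_def AC0_many_one_reducible_def
  using AC0_to_bool to_bool_correct AC0_to_three to_three_correct by blast

end
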